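(* Let $R$ be a NIP ring and let $S\subseteq R$ be a multiplicative subset. Then the localization $S^{-1}R$ and the canonical homomorphism $R\to S^{-1}R$ are interpretable in the Shelah expansion $R^{\mathrm{Sh}}$.
   Context: All rings are commutative and unital. A ring is NIP if its complete theory in the language of rings is NIP. A subset $D\subseteq R^n$ is externally definable if $D=\phi(R,b)$ for some formula $\phi(x,y)$ and some tuple $b$ from an elementary extension of $R$. The Shelah expansion $R^{\mathrm{Sh}}$ is the expansion of $R$ by predicates for all externally definable sets; when $R$ is NIP, the definable sets of $R^{\mathrm{Sh}}$ are exactly the externally definable sets of $R$, and $R^{\mathrm{Sh}}$ is NIP. *)

theory Defs
  imports "HOL-Algebra.Ring"
begin

section \<open>First-order logic\<close>

record ('f, 'r) language =
  fun_syms :: "'f set"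
  rel_syms :: "'r set"
  fun_arity :: "'f \<Rightarrow> nat"
  rel_arity :: "'r \<Rightarrow> nat"

datatype 'f trm = Var nat | App 'f "'f trm list"

datatype ('f, 'r) fm =
    Eq "'f trm" "'f trm"
  | Rel 'r "'f trm list"
  | Neg "('f, 'r) fm"
  | Conj "('f, 'r) fm" "('f, 'r) fm"
  | Exists nat "('f, 'r) fm"

fun wf_trm :: "('f, 'r) language \<Rightarrow> 'f trm \<Rightarrow> bool" where
  "wf_trm L (Var i) \<longleftrightarrow> True"
| "wf_trm L (App f ts) \<longleftrightarrow>
     f \<in> fun_syms L \<and> length ts = fun_arity L f \<and> (\<forall>t\<in>set ts. wf_trm L t)"

primrec wf_fm :: "('f, 'r) language \<Rightarrow> ('f, 'r) fm \<Rightarrow> bool" where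
  "wf_fm L (Eq s t) \<longleftrightarrow> wf_trm L s \<and> wf_trm L t"
| "wf_fm L (Rel r ts) \<longleftrightarrow>
     r \<in> rel_syms L \<and> length ts = rel_arity L r \<and> (\<forall>t\<in>set ts. wf_trm L t)"
| "wf_fm L (Neg \<phi>) \<longleftrightarrow> wf_fm L \<phi>"
| "wf_fm L (Conj \<phi> \<psi>) \<longleftrightarrow> wf_fm L \<phi> \<and> wf_fm L \<psi>"
| "wf_fm L (Exists i \<phi>) \<longleftrightarrow> wf_fm L \<phi>"

fun vars_trm :: "'f trm \<Rightarrow> nat set" where
  "vars_trm (Var i) = {i}"
| "vars_trm (App f ts) = (\<Union>t\<in>set ts. vars_trm t)"

primrec free_vars :: "('f, 'r) fm \<Rightarrow> nat set" where
  "free_vars (Eq s t) = vars_trm s \<union> vars_trm t"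
| "free_vars (Rel r ts) = (\<Union>t\<in>set ts. vars_trm t)"
| "free_vars (Neg \<phi>) = free_vars \<phi>"
| "free_vars (Conj \<phi> \<psi>) = free_vars \<phi> \<union> free_vars \<psi>"
| "free_vars (Exists i \<phi>) = free_vars \<phi> - {i}"

definition formula :: "('f, 'r) language \<Rightarrow> nat \<Rightarrow> ('f, 'r) fm \<Rightarrow> bool" where
  "formula L n \<phi> \<longleftrightarrow> wf_fm L \<phi> \<and> free_vars \<phi> \<subseteq> {..<n}"

record ('a, 'f, 'r) fo_struct =
  univ :: "'a set"
  fun_interp :: "'f \<Rightarrow> 'a list \<Rightarrow> 'a"
  rel_interp :: "'r \<Rightarrow> 'a list \<Rightarrow> bool"

definition tuples :: "'a set \<Rightarrow> nat \<Rightarrow> 'a list set" where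
  "tuples A n = {as. length as = n \<and> set as \<subseteq> A}"

definition is_structure :: "('f, 'r) language \<Rightarrow> ('a, 'f, 'r) fo_struct \<Rightarrow> bool" where
  "is_structure L M \<longleftrightarrow> univ M \<noteq> {} \<and>
     (\<forall>f\<in>fun_syms L. \<forall>as\<in>tuples (univ M) (fun_arity L f). fun_interp M f as \<in> univ M)"

primrec eval_trm :: "('a, 'f, 'r) fo_struct \<Rightarrow> (nat \<Rightarrow> 'a) \<Rightarrow> 'f trm \<Rightarrow> 'a" where
  "eval_trm M e (Var i) = e i"
| "eval_trm M e (App f ts) = fun_interp M f (map (eval_trm M e) ts)"

primrec sat :: "('a, 'f, 'r) fo_struct \<Rightarrow> (nat \<Rightarrow> 'a) \<Rightarrow> ('f, 'r) fm \<Rightarrow> bool" where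
  "sat M e (Eq s t) \<longleftrightarrow> eval_trm M e s = eval_trm M e t"
| "sat M e (Rel r ts) \<longleftrightarrow> rel_interp M r (map (eval_trm M e) ts)"
| "sat M e (Neg \<phi>) \<longleftrightarrow> \<not> sat M e \<phi>"
| "sat M e (Conj \<phi> \<psi>) \<longleftrightarrow> sat M e \<phi> \<and> sat M e \<psi>"
| "sat M e (Exists i \<phi>) \<longleftrightarrow> (\<exists>a\<in>univ M. sat M (e(i := a)) \<phi>)"

text \<open>\<open>holds M \<phi> as\<close> is \<open>M \<Turnstile> \<phi>(as)\<close>. It is only used when the free variables of \<open>\<phi>\<close> are
  below the length of \<open>as\<close>, so the unspecified values of \<open>(!)\<close> play no role.\<close>

definition holds :: "('a, 'f, 'r) fo_struct \<Rightarrow> ('f, 'r) fm \<Rightarrow> 'a list \<Rightarrow> bool" where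
  "holds M \<phi> as \<longleftrightarrow> sat M (\<lambda>i. as ! i) \<phi>"

section \<open>Complete theories and NIP\<close>

definition complete_theory ::
  "('f, 'r) language \<Rightarrow> ('a, 'f, 'r) fo_struct \<Rightarrow> ('f, 'r) fm set" where
  "complete_theory L M = {\<phi>. formula L 0 \<phi> \<and> holds M \<phi> []}"

definition models ::
  "('f, 'r) language \<Rightarrow> ('a, 'f, 'r) fo_struct \<Rightarrow> ('f, 'r) fm set \<Rightarrow> bool" where
  "models L M T \<longleftrightarrow> is_structure L M \<and> (\<forall>\<phi>\<in>T. holds M \<phi> [])"

text \<open>The variables of a partitioned formula \<open>\<phi>(x;y)\<close> with \<open>|x| = k\<close> and \<open>|y| = l\<close> are numbered
  \<open>0, \<dots>, k - 1\<close> and \<open>k, \<dots>, k + l - 1\<close>. The formula has the independence property if some model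
  of the theory contains tuples \<open>a\<^sub>i\<close> and \<open>b\<^sub>I\<close>, for \<open>i\<close> a natural number and \<open>I\<close> a set
  of natural numbers, such that \<open>\<phi>(a\<^sub>i; b\<^sub>I)\<close> holds iff \<open>i \<in> I\<close>.

  HOL has no quantifier over types, so the models range over the subsets of a fixed type of
  cardinality \<open>2\<^sup>\<kappa>\<close>, where \<open>\<kappa>\<close> is the number of formulas. This is no restriction: by
  the downward Loewenheim-Skolem theorem, if there is a model with such tuples then there is one
  with at most \<open>\<kappa> + 2\<^sup>\<omega>\<close> elements.\<close>

definition NIP_theory :: "('f, 'r) language \<Rightarrow> ('f, 'r) fm set \<Rightarrow> bool" where
  "NIP_theory L T \<longleftrightarrow> (\<forall>k l \<phi>. formula L (k + l) \<phi> \<longrightarrow>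
     \<not> (\<exists>(M :: (('f, 'r) fm set, 'f, 'r) fo_struct) a b. models L M T \<and>
          (\<forall>i :: nat. a i \<in> tuples (univ M) k) \<and>
          (\<forall>I :: nat set. b I \<in> tuples (univ M) l) \<and>
          (\<forall>i I. holds M \<phi> (a i @ b I) \<longleftrightarrow> i \<in> I)))"

section \<open>Definable and externally definable sets\<close>

text \<open>Definability is with parameters.\<close>

definition definable ::
  "('f, 'r) language \<Rightarrow> ('a, 'f, 'r) fo_struct \<Rightarrow> nat \<Rightarrow> 'a list set \<Rightarrow> bool" where
  "definable L M n D \<longleftrightarrow> (\<exists>\<phi> m. \<exists>b\<in>tuples (univ M) m.
     formula L (n + m) \<phi> \<and> D = {a \<in> tuples (univ M) n. holds M \<phi> (a @ b)})"

definition elementary_embedding ::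
  "('f, 'r) language \<Rightarrow> ('a, 'f, 'r) fo_struct \<Rightarrow> ('b, 'f, 'r) fo_struct \<Rightarrow> ('a \<Rightarrow> 'b) \<Rightarrow> bool" where
  "elementary_embedding L M N j \<longleftrightarrow> j ` univ M \<subseteq> univ N \<and>
     (\<forall>n \<phi>. \<forall>a\<in>tuples (univ M) n. formula L n \<phi> \<longrightarrow> holds N \<phi> (map j a) = holds M \<phi> a)"

text \<open>Elementary extensions are presented by elementary embeddings. Their elements are taken from
  a fixed type which is larger than \<open>|M| + |L| + \<omega>\<close>. This is no restriction: if \<open>D = \<phi>(M, b)\<close>
  for some tuple \<open>b\<close> from an elementary extension \<open>N\<close>, then by the downward Loewenheim-Skolem
  theorem \<open>N\<close> can be replaced by an elementary substructure with at most \<open>|M| + |L| + \<omega>\<close>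
  elements that contains \<open>M\<close> and \<open>b\<close>.\<close>

type_synonym ('a, 'f, 'r) ext_elem = "('a + ('f, 'r) fm) list set"

definition externally_definable ::
  "('f, 'r) language \<Rightarrow> ('a, 'f, 'r) fo_struct \<Rightarrow> nat \<Rightarrow> 'a list set \<Rightarrow> bool" where
  "externally_definable L M n D \<longleftrightarrow>
     (\<exists>(N :: (('a, 'f, 'r) ext_elem, 'f, 'r) fo_struct) j \<phi> m. \<exists>b\<in>tuples (univ N) m.
        is_structure L N \<and> elementary_embedding L M N j \<and> formula L (n + m) \<phi> \<and>
        D = {a \<in> tuples (univ M) n. holds N \<phi> (map j a @ b)})"

text \<open>The new relation symbols of the Shelah expansion are the pairs \<open>(n, D)\<close> where \<open>D\<close> is an
  externally definable set of \<open>n\<close>-tuples.\<close>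

definition shelah_language ::
  "('f, 'r) language \<Rightarrow> ('a, 'f, 'r) fo_struct \<Rightarrow> ('f, 'r + nat \<times> 'a list set) language" where
  "shelah_language L M =
     \<lparr>fun_syms = fun_syms L,
      rel_syms = Inl ` rel_syms L \<union> Inr ` {(n, D). externally_definable L M n D},
      fun_arity = fun_arity L,
      rel_arity = case_sum (rel_arity L) fst\<rparr>"

definition shelah_expansion ::
  "('a, 'f, 'r) fo_struct \<Rightarrow> ('a, 'f, 'r + nat \<times> 'a list set) fo_struct" where
  "shelah_expansion M =
     \<lparr>univ = univ M,
      fun_interp = fun_interp M,
      rel_interp = case_sum (rel_interp M) (\<lambda>(n, D) as. as \<in> D)\<rparr>"

section \<open>Interpretations\<close>

text \<open>An interpretation of \<open>N\<close> (in the language \<open>K\<close>) in \<open>M\<close> (in the language \<open>L\<close>) is a surjection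
  \<open>\<pi>\<close> from a definable set \<open>D\<close> of \<open>n\<close>-tuples of \<open>M\<close> onto \<open>N\<close> such that the preimages of equality,
  of the relations and of the graphs of the functions of \<open>N\<close> are definable in \<open>M\<close>. Here a tuple of
  elements of \<open>D\<close> is identified with the concatenation of its entries.\<close>

definition is_interpretation ::
  "('f, 'r) language \<Rightarrow> ('a, 'f, 'r) fo_struct \<Rightarrow> ('g, 's) language \<Rightarrow> ('b, 'g, 's) fo_struct \<Rightarrow>
   nat \<Rightarrow> 'a list set \<Rightarrow> ('a list \<Rightarrow> 'b) \<Rightarrow> bool" where
  "is_interpretation L M K N n D \<pi> \<longleftrightarrow>
     definable L M n D \<and> \<pi> ` D = univ N \<and>
     definable L M (n + n) {d @ d' | d d'. d \<in> D \<and> d' \<in> D \<and> \<pi> d = \<pi> d'} \<and>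
     (\<forall>r\<in>rel_syms K. definable L M (rel_arity K r * n)
        {concat ds | ds. ds \<in> tuples D (rel_arity K r) \<and> rel_interp N r (map \<pi> ds)}) \<and>
     (\<forall>f\<in>fun_syms K. definable L M (fun_arity K f * n + n)
        {concat ds @ d | ds d. ds \<in> tuples D (fun_arity K f) \<and> d \<in> D \<and>
           fun_interp N f (map \<pi> ds) = \<pi> d})"

text \<open>A structure \<open>N\<close> together with a map \<open>h\<close> from \<open>M\<close> to \<open>N\<close> is interpretable in \<open>M\<close> if \<open>N\<close> has an
  interpretation in \<open>M\<close> for which the preimage of the graph of \<open>h\<close> is definable.\<close>

definition interpretable_with_map ::
  "('f, 'r) language \<Rightarrow> ('a, 'f, 'r) fo_struct \<Rightarrow> ('g, 's) language \<Rightarrow> ('b, 'g, 's) fo_struct \<Rightarrow>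
   ('a \<Rightarrow> 'b) \<Rightarrow> bool" where
  "interpretable_with_map L M K N h \<longleftrightarrow> (\<exists>n D \<pi>. is_interpretation L M K N n D \<pi> \<and>
     definable L M (1 + n) {[a] @ d | a d. a \<in> univ M \<and> d \<in> D \<and> h a = \<pi> d})"

section \<open>Rings as first-order structures\<close>

datatype ring_sym = Zero_sym | One_sym | Add_sym | Minus_sym | Mult_sym

text \<open>The language of rings \<open>{0, 1, +, -, \<cdot>}\<close>, with unary \<open>-\<close>. It has no relation symbols; \<open>unit\<close> is
  a dummy type.\<close>

definition ring_language :: "(ring_sym, unit) language" where
  "ring_language =
     \<lparr>fun_syms = UNIV, rel_syms = {},
      fun_arity = case_ring_sym 0 0 2 1 2, rel_arity = (\<lambda>_. 0)\<rparr>"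

definition ring_structure :: "('a, 'm) ring_scheme \<Rightarrow> ('a, ring_sym, unit) fo_struct" where
  "ring_structure R =
     \<lparr>univ = carrier R,
      fun_interp = (\<lambda>f as. case f of
          Zero_sym \<Rightarrow> \<zero>\<^bsub>R\<^esub>
        | One_sym \<Rightarrow> \<one>\<^bsub>R\<^esub>
        | Add_sym \<Rightarrow> as ! 0 \<oplus>\<^bsub>R\<^esub> as ! 1
        | Minus_sym \<Rightarrow> \<ominus>\<^bsub>R\<^esub> (as ! 0)
        | Mult_sym \<Rightarrow> as ! 0 \<otimes>\<^bsub>R\<^esub> as ! 1),
      rel_interp = (\<lambda>_ _. False)\<rparr>"

definition NIP_ring :: "('a, 'm) ring_scheme \<Rightarrow> bool" where
  "NIP_ring R \<longleftrightarrow> NIP_theory ring_language (complete_theory ring_language (ring_structure R))"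

section \<open>Localization\<close>

definition loc_rel :: "('a, 'm) ring_scheme \<Rightarrow> 'a set \<Rightarrow> (('a \<times> 'a) \<times> 'a \<times> 'a) set" where
  "loc_rel R S = {((a, s), (b, t)). a \<in> carrier R \<and> b \<in> carrier R \<and> s \<in> S \<and> t \<in> S \<and>
     (\<exists>u\<in>S. u \<otimes>\<^bsub>R\<^esub> (a \<otimes>\<^bsub>R\<^esub> t \<ominus>\<^bsub>R\<^esub> b \<otimes>\<^bsub>R\<^esub> s) = \<zero>\<^bsub>R\<^esub>)}"

definition loc_frac :: "('a, 'm) ring_scheme \<Rightarrow> 'a set \<Rightarrow> 'a \<Rightarrow> 'a \<Rightarrow> ('a \<times> 'a) set" where
  "loc_frac R S a s = loc_rel R S `` {(a, s)}"

text \<open>The unions over representatives below are unions of equal sets.\<close>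

definition localization :: "('a, 'm) ring_scheme \<Rightarrow> 'a set \<Rightarrow> ('a \<times> 'a) set ring" where
  "localization R S =
     \<lparr>carrier = (carrier R \<times> S) // loc_rel R S,
      monoid.mult = (\<lambda>X Y. \<Union>(a, s)\<in>X. \<Union>(b, t)\<in>Y. loc_frac R S (a \<otimes>\<^bsub>R\<^esub> b) (s \<otimes>\<^bsub>R\<^esub> t)),
      one = loc_frac R S \<one>\<^bsub>R\<^esub> \<one>\<^bsub>R\<^esub>,
      zero = loc_frac R S \<zero>\<^bsub>R\<^esub> \<one>\<^bsub>R\<^esub>,
      add = (\<lambda>X Y. \<Union>(a, s)\<in>X. \<Union>(b, t)\<in>Y.
               loc_frac R S (a \<otimes>\<^bsub>R\<^esub> t \<oplus>\<^bsub>R\<^esub> b \<otimes>\<^bsub>R\<^esub> s) (s \<otimes>\<^bsub>R\<^esub> t))\<rparr>"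

definition localization_map :: "('a, 'm) ring_scheme \<Rightarrow> 'a set \<Rightarrow> 'a \<Rightarrow> ('a \<times> 'a) set" where
  "localization_map R S a = loc_frac R S a \<one>\<^bsub>R\<^esub>"

end

theory Submission
  imports Defs "HOL-Algebra.Multiplicative_Group"
begin

text \<open>As \<open>S\<close> is directed under divisibility, some element \<open>x\<close> of an elementary extension of \<open>R\<close>
  is a common multiple of \<open>S\<close> and shares with the elements of \<open>S\<close> the property of being divisible
  only by elements of the saturation of \<open>S\<close>, as far as divisors in \<open>R\<close> are concerned. So the
  saturation is the externally definable set of divisors of \<open>x\<close>, and for \<open>s, t\<close> in the saturation,
  \<open>a/s = b/t\<close> in \<open>S\<^sup>-\<^sup>1R\<close> iff \<open>x (a t - b s) = 0\<close>. Hence \<open>S\<^sup>-\<^sup>1R\<close> is interpreted on the pairs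
  \<open>(a, s)\<close> with \<open>s\<close> in the saturation.\<close>

section \<open>Ultrapowers\<close>

text \<open>Zorn's lemma yields a minimal proper filter below \<open>F\<close>. It decides every
  predicate, since otherwise its restriction to the complement would be a strictly finer proper
  filter.\<close>

lemma finer_ultrafilter:
  fixes F :: "'i filter"
  assumes "F \<noteq> bot"
  obtains U where "U \<le> F" "U \<noteq> bot"
    "\<And>P. \<not> eventually P U \<Longrightarrow> eventually (\<lambda>x. \<not> P x) U"
proof -
  define A where "A = {G. G \<noteq> bot \<and> G \<le> F}"
  \<comment> \<open>The order is reversed: \<open>predicate_Zorn\<close> produces maximal elements,
    while a minimal filter is wanted.\<close>
  define ge :: "'i filter \<Rightarrow> 'i filter \<Rightarrow> bool" where "ge G H \<longleftrightarrow> H \<le> G" for G H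
  have "\<exists>m\<in>A. \<forall>a\<in>A. ge m a \<longrightarrow> a = m"
  proof (rule predicate_Zorn)
    show "partial_order_on A (relation_of ge A)"
      by (auto simp: partial_order_on_def preorder_on_def refl_on_def trans_def antisym_def
          relation_of_def ge_def)
    fix C assume C: "C \<in> Chains (relation_of ge A)"
    show "\<exists>u\<in>A. \<forall>a\<in>C. ge a u"
    proof (cases "C = {}")
      case True
      with assms show ?thesis by (auto simp: A_def)
    next
      case False
      have CA: "C \<subseteq> A" and dir: "\<And>G H. G \<in> C \<Longrightarrow> H \<in> C \<Longrightarrow> G \<le> H \<or> H \<le> G"
        using C by (auto simp: Chains_def relation_of_def ge_def)
      \<comment> \<open>Along a chain the infimum contains nothing beyond the union of its members,
        so it stays proper.\<close>
      have "eventually P (Inf C) \<longleftrightarrow> (\<exists>G\<in>C. eventually P G)" for P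
        using dir by (intro eventually_Inf_base False) (metis inf.absorb1 inf.absorb2 order_refl)
      then have "Inf C \<noteq> bot"
        using CA by (auto simp: trivial_limit_def A_def)
      moreover have "Inf C \<le> F"
        using False CA by (auto simp: A_def intro: Inf_lower2)
      ultimately show ?thesis
        by (auto simp: A_def ge_def intro: Inf_lower)
    qed
  qed
  then obtain U where U: "U \<noteq> bot" "U \<le> F" and min: "\<And>G. G \<noteq> bot \<Longrightarrow> G \<le> U \<Longrightarrow> G = U"
    by (auto simp: A_def ge_def)
  have "eventually (\<lambda>x. \<not> P x) U" if "\<not> eventually P U" for P
  proof -
    let ?G = "inf U (principal {x. \<not> P x})"
    have "?G \<noteq> bot"
      using that by (simp add: trivial_limit_def eventually_inf_principal)
    then have "?G = U" by (rule min) simp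
    moreover have "eventually (\<lambda>x. \<not> P x) ?G"
      by (simp add: eventually_inf_principal)
    ultimately show ?thesis by simp
  qed
  with U that show thesis by blast
qed

section \<open>Coincidence lemmas for terms and formulas\<close>

lemma eval_trm_cong:
  "(\<And>i. i \<in> vars_trm t \<Longrightarrow> e i = e' i) \<Longrightarrow> eval_trm M e t = eval_trm M e' t"
proof (induction t)
  case (App f ts)
  then have "map (eval_trm M e) ts = map (eval_trm M e') ts"
    by (intro map_cong) auto
  then show ?case by (simp del: map_eq_conv)
qed simp

lemma sat_cong:
  "(\<And>i. i \<in> free_vars \<phi> \<Longrightarrow> e i = e' i) \<Longrightarrow> sat M e \<phi> = sat M e' \<phi>"
proof (induction \<phi> arbitrary: e e')
  case (Eq s t)
  then show ?case using eval_trm_cong[of s e e' M] eval_trm_cong[of t e e' M] by simp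
next
  case (Rel r ts)
  then have "map (eval_trm M e) ts = map (eval_trm M e') ts"
    by (intro map_cong refl eval_trm_cong) auto
  then show ?case by (simp del: map_eq_conv)
next
  case (Neg \<phi>)
  show ?case using Neg.prems Neg.IH[of e e'] by simp
next
  case (Conj \<phi> \<psi>)
  show ?case using Conj.prems Conj.IH(1)[of e e'] Conj.IH(2)[of e e'] by simp
next
  case (Exists i \<phi>)
  have "sat M (e(i := a)) \<phi> = sat M (e'(i := a)) \<phi>" for a
    using Exists.prems by (intro Exists.IH) auto
  then show ?case by simp
qed

text \<open>Values of \<open>(!)\<close> beyond the length of the list are invisible to the formula,
  so any environment extending the list may be used instead.\<close>

lemma holds_eq_sat:
  assumes "formula L (length as) \<phi>" "\<And>i. i < length as \<Longrightarrow> e i = as ! i"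
  shows "holds M \<phi> as = sat M e \<phi>"
  unfolding holds_def using assms by (intro sat_cong) (auto simp: formula_def)

text \<open>The map \<open>c\<close> sends a function to a code of its class modulo \<open>U\<close>.\<close>

locale ultrapower =
  fixes M :: "('a, 'f, 'r) fo_struct" and U :: "'i filter" and c :: "('i \<Rightarrow> 'a) \<Rightarrow> 'b"
  assumes not_bot: "U \<noteq> bot"
    and ultra: "\<And>P. \<not> eventually P U \<Longrightarrow> eventually (\<lambda>x. \<not> P x) U"
    and c_eq_iff: "\<And>f g. c f = c g \<longleftrightarrow> (\<forall>\<^sub>F x in U. f x = g x)"
begin

definition rep :: "'b \<Rightarrow> 'i \<Rightarrow> 'a" where
  "rep = inv_into UNIV c"

text \<open>Operations are computed on the representatives chosen by \<open>rep\<close>, hence are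
  well defined outright. That other representatives give the same result follows from
  \<open>rep_c\<close> and \<open>c_eq_iff\<close>.\<close>

definition ultrapower :: "('b, 'f, 'r) fo_struct" where
  "ultrapower =
     \<lparr>univ = c ` {f. \<forall>\<^sub>F x in U. f x \<in> univ M},
      fun_interp = (\<lambda>F as. c (\<lambda>x. fun_interp M F (map (\<lambda>a. rep a x) as))),
      rel_interp = (\<lambda>r as. \<forall>\<^sub>F x in U. rel_interp M r (map (\<lambda>a. rep a x) as))\<rparr>"

lemma univ_ultrapower: "univ ultrapower = c ` {f. \<forall>\<^sub>F x in U. f x \<in> univ M}"
  by (simp add: ultrapower_def)

lemma eventually_not_iff: "eventually (\<lambda>x. \<not> P x) U \<longleftrightarrow> \<not> eventually P U"
proof
  assume "eventually (\<lambda>x. \<not> P x) U"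
  then show "\<not> eventually P U"
    using not_bot eventually_conj[of P U "\<lambda>x. \<not> P x"] by (auto simp: trivial_limit_def)
qed (rule ultra)

lemma rep_c: "\<forall>\<^sub>F x in U. rep (c f) x = f x"
  unfolding c_eq_iff[symmetric] rep_def by (rule f_inv_into_f[of "c f" c UNIV, OF rangeI])

text \<open>Each argument has its own exceptional set of indices; a list has only finitely many, so
  they can be avoided together.\<close>

lemma rep_c_list: "\<forall>\<^sub>F x in U. map (\<lambda>a. rep a x) (map (\<lambda>t. c (g t)) ts) = map (\<lambda>t. g t x) ts"
proof -
  have "\<forall>\<^sub>F x in U. \<forall>t\<in>set ts. rep (c (g t)) x = g t x"
    using rep_c by (intro eventually_ball_finite) auto
  then show ?thesis by (rule eventually_mono) auto
qed

lemma eval_trm_ultrapower: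
  "eval_trm ultrapower (\<lambda>i. c (e i)) t = c (\<lambda>x. eval_trm M (\<lambda>i. e i x) t)"
proof (induction t)
  case (App f ts)
  then have *: "map (eval_trm ultrapower (\<lambda>i. c (e i))) ts
      = map (\<lambda>t. c (\<lambda>x. eval_trm M (\<lambda>i. e i x) t)) ts"
    by (intro map_cong) auto
  show ?case
    unfolding eval_trm.simps * unfolding ultrapower_def fo_struct.simps c_eq_iff
    using rep_c_list[of "\<lambda>t x. eval_trm M (\<lambda>i. e i x) t" ts]
    by (rule eventually_mono) (simp del: map_map map_eq_conv)
qed simp

text \<open>Los's theorem. The negation case is where the filter has to be an ultrafilter.\<close>

lemma sat_ultrapower:
  "sat ultrapower (\<lambda>i. c (e i)) \<phi> \<longleftrightarrow> (\<forall>\<^sub>F x in U. sat M (\<lambda>i. e i x) \<phi>)"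
proof (induction \<phi> arbitrary: e)
  case (Eq s t)
  then show ?case by (simp add: eval_trm_ultrapower c_eq_iff)
next
  case (Rel r ts)
  have *: "map (eval_trm ultrapower (\<lambda>i. c (e i))) ts
      = map (\<lambda>t. c (\<lambda>x. eval_trm M (\<lambda>i. e i x) t)) ts"
    by (simp add: eval_trm_ultrapower)
  show ?case
    unfolding sat.simps * unfolding ultrapower_def fo_struct.simps
    by (rule eventually_cong[OF rep_c_list[of "\<lambda>t x. eval_trm M (\<lambda>i. e i x) t" ts]])
      (simp del: map_map map_eq_conv)
next
  case (Neg \<phi>)
  then show ?case by (simp add: eventually_not_iff)
next
  case (Conj \<phi> \<psi>)
  then show ?case by (simp add: eventually_conj_iff)
next
  case (Exists i \<phi>)
  have upd: "(\<lambda>j. c (e j))(i := c f) = (\<lambda>j. c ((e(i := f)) j))" for f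
    by auto
  have updx: "(\<lambda>j. (e(i := f)) j x) = (\<lambda>j. e j x)(i := f x)" for f x
    by auto
  have "sat ultrapower (\<lambda>i. c (e i)) (Exists i \<phi>) \<longleftrightarrow>
      (\<exists>f. (\<forall>\<^sub>F x in U. f x \<in> univ M) \<and> (\<forall>\<^sub>F x in U. sat M ((\<lambda>j. e j x)(i := f x)) \<phi>))"
    by (auto simp: univ_ultrapower upd Exists.IH updx simp del: fun_upd_apply)
  also have "\<dots> \<longleftrightarrow> (\<exists>f. \<forall>\<^sub>F x in U. f x \<in> univ M \<and> sat M ((\<lambda>j. e j x)(i := f x)) \<phi>)"
    by (simp add: eventually_conj_iff)
  \<comment> \<open>Witnesses chosen separately at each index are assembled into one function, whose
    class is the witness in the ultrapower.\<close>
  also have "\<dots> \<longleftrightarrow> (\<forall>\<^sub>F x in U. \<exists>a. a \<in> univ M \<and> sat M ((\<lambda>j. e j x)(i := a)) \<phi>)"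
    by (rule eventually_ex[symmetric])
  finally show ?case by (simp add: Bex_def)
qed

lemma holds_ultrapower:
  assumes "formula L (length fs) \<phi>"
  shows "holds ultrapower \<phi> (map c fs) \<longleftrightarrow> (\<forall>\<^sub>F x in U. holds M \<phi> (map (\<lambda>f. f x) fs))"
proof -
  have "holds M \<phi> (map (\<lambda>f. f x) fs) = sat M (\<lambda>i. (fs ! i) x) \<phi>" for x
    using assms by (intro holds_eq_sat) auto
  moreover have "holds ultrapower \<phi> (map c fs) = sat ultrapower (\<lambda>i. c (fs ! i)) \<phi>"
    using assms by (intro holds_eq_sat) auto
  ultimately show ?thesis by (simp add: sat_ultrapower)
qed

lemma elementary_embedding_ultrapower: "elementary_embedding L M ultrapower (\<lambda>a. c (\<lambda>_. a))"
  unfolding elementary_embedding_def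
proof (intro conjI allI ballI impI)
  show "(\<lambda>a. c (\<lambda>_. a)) ` univ M \<subseteq> univ ultrapower"
    by (auto simp: univ_ultrapower)
  fix n \<phi> as assume "as \<in> tuples (univ M) n" "formula L n \<phi>"
  then show "holds ultrapower \<phi> (map (\<lambda>a. c (\<lambda>_. a)) as) = holds M \<phi> as"
    \<comment> \<open>For constant functions the condition does not depend on the index, and as
      \<open>U\<close> is proper, such a condition holds eventually iff it is true.\<close>
    using holds_ultrapower[of L "map (\<lambda>a _. a) as" \<phi>] not_bot by (simp add: tuples_def o_def)
qed

lemma is_structure_ultrapower:
  assumes "is_structure L M"
  shows "is_structure L ultrapower"
  unfolding is_structure_def
proof (intro conjI ballI)
  obtain a where "a \<in> univ M" using assms by (auto simp: is_structure_def)
  then have "c (\<lambda>_. a) \<in> univ ultrapower" by (auto simp: univ_ultrapower)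
  then show "univ ultrapower \<noteq> {}" by blast
  fix F as assume F: "F \<in> fun_syms L" and as: "as \<in> tuples (univ ultrapower) (fun_arity L F)"
  have "\<forall>\<^sub>F x in U. rep a x \<in> univ M" if a: "a \<in> set as" for a
  proof -
    obtain f where f: "a = c f" "\<forall>\<^sub>F x in U. f x \<in> univ M"
      using a as unfolding tuples_def univ_ultrapower by blast
    from rep_c[of f] f(2) show ?thesis
      unfolding f(1) by eventually_elim simp
  qed
  then have "\<forall>\<^sub>F x in U. \<forall>a\<in>set as. rep a x \<in> univ M"
    by (intro eventually_ball_finite) auto
  then have "\<forall>\<^sub>F x in U. fun_interp M F (map (\<lambda>a. rep a x) as) \<in> univ M"
  proof (rule eventually_mono)
    fix x assume "\<forall>a\<in>set as. rep a x \<in> univ M"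
    with as have "map (\<lambda>a. rep a x) as \<in> tuples (univ M) (fun_arity L F)"
      by (auto simp: tuples_def)
    with assms F show "fun_interp M F (map (\<lambda>a. rep a x) as) \<in> univ M"
      unfolding is_structure_def by blast
  qed
  then show "fun_interp ultrapower F as \<in> univ ultrapower"
    by (auto simp: ultrapower_def)
qed

end

text \<open>The parameter defining the set is the class of the identity in the ultrapower \<open>M\<^sup>U\<close>; the
  index type is that of \<open>M\<close>, so that classes can be coded in the type of extension elements.\<close>

lemma externally_definable_eventually:
  fixes M :: "('a, 'f, 'r) fo_struct" and U :: "'a filter"
  assumes M: "is_structure L M"
    and U: "U \<noteq> bot" "\<And>P. \<not> eventually P U \<Longrightarrow> eventually (\<lambda>x. \<not> P x) U"
      "\<forall>\<^sub>F x in U. x \<in> univ M"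
    and \<phi>: "formula L (n + 1) \<phi>"
  shows "externally_definable L M n
    {as \<in> tuples (univ M) n. \<forall>\<^sub>F x in U. holds M \<phi> (as @ [x])}"
proof -
  \<comment> \<open>The graph of \<open>f\<close>, written as a set of lists of length 2, is an
    injective code inside the type \<open>ext_elem\<close>.\<close>
  define code :: "('a \<Rightarrow> 'a) \<Rightarrow> ('a, 'f, 'r) ext_elem"
    where "code f = range (\<lambda>x. [Inl x, Inl (f x)])" for f
  \<comment> \<open>Functions that agree almost everywhere satisfy the same predicate under
    \<open>SOME\<close>, so they receive the same representative and the same code.\<close>
  define c where "c f = code (SOME g. \<forall>\<^sub>F x in U. f x = g x)" for f
  have code: "code f = code g \<Longrightarrow> f = g" for f g
    unfolding code_def by (rule ext) (auto dest!: equalityD1 simp: subset_eq)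
  have c: "c f = c g \<longleftrightarrow> (\<forall>\<^sub>F x in U. f x = g x)" for f g
  proof
    have some: "\<forall>\<^sub>F x in U. f x = (SOME g. \<forall>\<^sub>F x in U. f x = g x) x" for f
      by (rule someI[of "\<lambda>g. \<forall>\<^sub>F x in U. f x = g x" f]) simp
    assume "c f = c g"
    then have "(SOME h. \<forall>\<^sub>F x in U. f x = h x) = (SOME h. \<forall>\<^sub>F x in U. g x = h x)"
      unfolding c_def by (rule code)
    with some[of f] some[of g] show "\<forall>\<^sub>F x in U. f x = g x"
      by (auto elim: eventually_elim2)
  next
    assume fg: "\<forall>\<^sub>F x in U. f x = g x"
    have "(\<forall>\<^sub>F x in U. f x = h x) \<longleftrightarrow> (\<forall>\<^sub>F x in U. g x = h x)" for h
      by (rule eventually_cong[OF fg]) simp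
    then show "c f = c g" by (simp add: c_def)
  qed
  interpret ultrapower M U c
    using U(1,2) c by unfold_locales
  have id: "[c (\<lambda>x. x)] \<in> tuples (univ ultrapower) 1"
    using U(3) by (auto simp: tuples_def univ_ultrapower)
  \<comment> \<open>Los's theorem for constant functions followed by the identity: at index
    \<open>x\<close> the last variable takes the value \<open>x\<close>.\<close>
  have "holds ultrapower \<phi> (map (\<lambda>a. c (\<lambda>_. a)) as @ [c (\<lambda>x. x)])
      \<longleftrightarrow> (\<forall>\<^sub>F x in U. holds M \<phi> (as @ [x]))" if "as \<in> tuples (univ M) n" for as
    using holds_ultrapower[of L "map (\<lambda>a _. a) as @ [\<lambda>x. x]" \<phi>] \<phi> that
    by (simp add: tuples_def o_def)
  then have "{as \<in> tuples (univ M) n. \<forall>\<^sub>F x in U. holds M \<phi> (as @ [x])}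
      = {as \<in> tuples (univ M) n. holds ultrapower \<phi> (map (\<lambda>a. c (\<lambda>_. a)) as @ [c (\<lambda>x. x)])}"
    by blast
  with id \<phi> is_structure_ultrapower[OF M] elementary_embedding_ultrapower show ?thesis
    unfolding externally_definable_def by blast
qed

text \<open>The expansion has a relation symbol naming \<open>D\<close>, so an atomic formula
  without parameters defines it.\<close>

lemma definable_shelah_expansion:
  assumes "externally_definable L M n D"
  shows "definable (shelah_language L M) (shelah_expansion M) n D"
proof -
  let ?\<phi> = "Rel (Inr (n, D)) (map Var [0..<n])"
  have "formula (shelah_language L M) (n + 0) ?\<phi>"
    using assms by (auto simp: formula_def shelah_language_def)
  moreover have "D = {as \<in> tuples (univ (shelah_expansion M)) n. holds (shelah_expansion M) ?\<phi> (as @ [])}"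
  proof -
    have "map (eval_trm (shelah_expansion M) ((!) as)) (map Var [0..<n]) = as"
      if "length as = n" for as
      using that map_nth[of as] by (simp add: o_def)
    moreover have "D \<subseteq> tuples (univ M) n"
      using assms by (auto simp: externally_definable_def)
    ultimately show ?thesis
      by (auto simp: holds_def shelah_expansion_def tuples_def o_def)
  qed
  moreover have "[] \<in> tuples (univ (shelah_expansion M)) 0" by (simp add: tuples_def)
  ultimately show ?thesis unfolding definable_def by blast
qed

section \<open>Localizations\<close>

locale localized_ring = cring R for R (structure) +
  fixes S :: "'a set"
  assumes submonoid: "submonoid S R"
begin

lemma S_carrier [simp]: "s \<in> S \<Longrightarrow> s \<in> carrier R"
  using submonoid by (auto simp: submonoid_def)

lemma S_one [simp]: "\<one> \<in> S"
  using submonoid by (auto simp: submonoid_def)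

lemma S_mult [simp]: "s \<in> S \<Longrightarrow> t \<in> S \<Longrightarrow> s \<otimes> t \<in> S"
  using submonoid by (auto simp: submonoid_def)

definition saturation :: "'a set" where
  "saturation = {s \<in> carrier R. \<exists>r\<in>carrier R. r \<otimes> s \<in> S}"

text \<open>The cross-multiplied form avoids subtraction and becomes a single equation of ring terms
  once a fixed \<open>x\<close> takes the place of \<open>u\<close>. Membership of the denominators
  is kept separate.\<close>

definition frac_eq :: "'a \<Rightarrow> 'a \<Rightarrow> 'a \<Rightarrow> 'a \<Rightarrow> bool" where
  "frac_eq a s b t \<longleftrightarrow> (\<exists>u\<in>S. u \<otimes> (a \<otimes> t) = u \<otimes> (b \<otimes> s))"

text \<open>The element \<open>a/s\<close> of \<open>S\<^sup>-\<^sup>1R\<close>, also for denominators in the saturation of \<open>S\<close>.\<close>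

definition fraction :: "'a \<Rightarrow> 'a \<Rightarrow> ('a \<times> 'a) set" where
  "fraction a s = {(b, t). b \<in> carrier R \<and> t \<in> S \<and> frac_eq a s b t}"

lemma S_saturation [simp]: "s \<in> S \<Longrightarrow> s \<in> saturation"
  by (auto simp: saturation_def intro!: bexI[of _ \<one>])

lemma saturation_carrier [simp]: "s \<in> saturation \<Longrightarrow> s \<in> carrier R"
  by (simp add: saturation_def)

lemma saturation_mult [simp]:
  assumes "s \<in> saturation" "t \<in> saturation"
  shows "s \<otimes> t \<in> saturation"
proof -
  obtain r r' where r: "r \<in> carrier R" "r \<otimes> s \<in> S" "r' \<in> carrier R" "r' \<otimes> t \<in> S"
    using assms unfolding saturation_def by blast
  have "(r \<otimes> r') \<otimes> (s \<otimes> t) = (r \<otimes> s) \<otimes> (r' \<otimes> t)"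
    using r assms by (simp add: m_ac)
  with r have "(r \<otimes> r') \<otimes> (s \<otimes> t) \<in> S" by simp
  with r(1,3) assms[THEN saturation_carrier] show ?thesis
    unfolding saturation_def by (blast intro: m_closed)
qed

section \<open>Calculus of fractions with denominators in the saturation\<close>

lemma frac_eqI:
  assumes "a \<otimes> t = b \<otimes> s"
  shows "frac_eq a s b t"
  unfolding frac_eq_def assms using S_one by blast

lemma frac_eq_sym: "frac_eq a s b t \<Longrightarrow> frac_eq b t a s"
  unfolding frac_eq_def by metis

text \<open>The usual multiplier \<open>u \<otimes> v \<otimes> t\<close> may fall outside
  \<open>S\<close>, as \<open>t\<close> is only in the saturation. A cofactor \<open>r\<close> with
  \<open>r \<otimes> t\<close> in \<open>S\<close> repairs this.\<close>

lemma frac_eq_trans: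
  assumes "frac_eq a s b t" "frac_eq b t c w"
    and "a \<in> carrier R" "b \<in> carrier R" "c \<in> carrier R"
    and "s \<in> carrier R" "t \<in> saturation" "w \<in> carrier R"
  shows "frac_eq a s c w"
proof -
  obtain u v r where u: "u \<in> S" "u \<otimes> (a \<otimes> t) = u \<otimes> (b \<otimes> s)"
    and v: "v \<in> S" "v \<otimes> (b \<otimes> w) = v \<otimes> (c \<otimes> t)"
    and r: "r \<in> carrier R" "r \<otimes> t \<in> S"
    using assms unfolding frac_eq_def saturation_def by blast
  have [simp]: "t \<in> carrier R" "u \<in> carrier R" "v \<in> carrier R" using assms(7) u v by auto
  have "(u \<otimes> v \<otimes> (r \<otimes> t)) \<otimes> (a \<otimes> w) = (u \<otimes> (a \<otimes> t)) \<otimes> (v \<otimes> r \<otimes> w)"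
    using assms r by (simp add: m_ac)
  also have "\<dots> = (v \<otimes> (b \<otimes> w)) \<otimes> (u \<otimes> r \<otimes> s)"
    unfolding u(2) using assms r by (simp add: m_ac)
  also have "\<dots> = (u \<otimes> v \<otimes> (r \<otimes> t)) \<otimes> (c \<otimes> s)"
    unfolding v(2) using assms r by (simp add: m_ac)
  finally show ?thesis
    unfolding frac_eq_def using u(1) v(1) r by (intro bexI[of _ "u \<otimes> v \<otimes> (r \<otimes> t)"]) auto
qed

text \<open>The product of the two multipliers works. This congruence gives independence of
  representatives for the product of the localization.\<close>

lemma frac_eq_mult:
  assumes "frac_eq a s a' s'" "frac_eq b t b' t'"
    and [simp]: "a \<in> carrier R" "b \<in> carrier R" "a' \<in> carrier R" "b' \<in> carrier R"
      "s \<in> carrier R" "t \<in> carrier R" "s' \<in> carrier R" "t' \<in> carrier R"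
  shows "frac_eq (a \<otimes> b) (s \<otimes> t) (a' \<otimes> b') (s' \<otimes> t')"
proof -
  obtain u v where u: "u \<in> S" "u \<otimes> (a \<otimes> s') = u \<otimes> (a' \<otimes> s)"
    and v: "v \<in> S" "v \<otimes> (b \<otimes> t') = v \<otimes> (b' \<otimes> t)"
    using assms by (auto simp: frac_eq_def)
  have [simp]: "u \<in> carrier R" "v \<in> carrier R" using u v by auto
  have "(u \<otimes> v) \<otimes> ((a \<otimes> b) \<otimes> (s' \<otimes> t')) = (u \<otimes> (a \<otimes> s')) \<otimes> (v \<otimes> (b \<otimes> t'))"
    by (simp add: m_ac)
  also have "\<dots> = (u \<otimes> v) \<otimes> ((a' \<otimes> b') \<otimes> (s \<otimes> t))"
    unfolding u(2) v(2) by (simp add: m_ac)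
  finally show ?thesis
    unfolding frac_eq_def using u(1) v(1) by (intro bexI[of _ "u \<otimes> v"]) auto
qed

lemma frac_eq_add:
  assumes "frac_eq a s a' s'" "frac_eq b t b' t'"
    and [simp]: "a \<in> carrier R" "b \<in> carrier R" "a' \<in> carrier R" "b' \<in> carrier R"
      "s \<in> carrier R" "t \<in> carrier R" "s' \<in> carrier R" "t' \<in> carrier R"
  shows "frac_eq (a \<otimes> t \<oplus> b \<otimes> s) (s \<otimes> t) (a' \<otimes> t' \<oplus> b' \<otimes> s') (s' \<otimes> t')"
proof -
  obtain u v where u: "u \<in> S" "u \<otimes> (a \<otimes> s') = u \<otimes> (a' \<otimes> s)"
    and v: "v \<in> S" "v \<otimes> (b \<otimes> t') = v \<otimes> (b' \<otimes> t)"
    using assms by (auto simp: frac_eq_def)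
  have [simp]: "u \<in> carrier R" "v \<in> carrier R" using u v by auto
  have "(u \<otimes> v) \<otimes> ((a \<otimes> t \<oplus> b \<otimes> s) \<otimes> (s' \<otimes> t'))
      = (u \<otimes> (a \<otimes> s')) \<otimes> (v \<otimes> t \<otimes> t') \<oplus> (v \<otimes> (b \<otimes> t')) \<otimes> (u \<otimes> s \<otimes> s')"
    by (simp add: m_ac l_distr r_distr)
  also have "\<dots> = (u \<otimes> v) \<otimes> ((a' \<otimes> t' \<oplus> b' \<otimes> s') \<otimes> (s \<otimes> t))"
    unfolding u(2) v(2) by (simp add: m_ac l_distr r_distr)
  finally show ?thesis
    unfolding frac_eq_def using u(1) v(1) by (intro bexI[of _ "u \<otimes> v"]) auto
qed

text \<open>Expanding by a cofactor moves the denominator into \<open>S\<close>, so the class is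
  nonempty even when \<open>s\<close> is only in the saturation.\<close>

lemma frac_mem:
  assumes "a \<in> carrier R" "s \<in> saturation"
  obtains b t where "(b, t) \<in> fraction a s"
proof -
  obtain r where r: "r \<in> carrier R" "r \<otimes> s \<in> S"
    using assms unfolding saturation_def by blast
  have "frac_eq a s (r \<otimes> a) (r \<otimes> s)"
    using r assms by (intro frac_eqI) (simp add: m_ac)
  with r assms have "(r \<otimes> a, r \<otimes> s) \<in> fraction a s" by (simp add: fraction_def)
  then show thesis by (rule that)
qed

lemma frac_subset:
  assumes "frac_eq a s b t"
    and "a \<in> carrier R" "b \<in> carrier R" "s \<in> saturation" "t \<in> saturation"
  shows "fraction b t \<subseteq> fraction a s"
proof clarify
  fix c w assume cw: "(c, w) \<in> fraction b t"
  then have "frac_eq a s c w"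
    by (intro frac_eq_trans[OF assms(1)]) (use assms in \<open>simp_all add: fraction_def\<close>)
  with cw show "(c, w) \<in> fraction a s" by (simp add: fraction_def)
qed

text \<open>A representative of the common class has its denominator in \<open>S\<close>, so it can
  be the middle term of transitivity. Equality in the localization thereby reduces to an equation in
  \<open>R\<close>.\<close>

lemma frac_eq_iff:
  assumes "a \<in> carrier R" "b \<in> carrier R" "s \<in> saturation" "t \<in> saturation"
  shows "fraction a s = fraction b t \<longleftrightarrow> frac_eq a s b t"
proof
  assume eq: "fraction a s = fraction b t"
  obtain c w where cw: "(c, w) \<in> fraction a s" using frac_mem assms by blast
  then have "(c, w) \<in> fraction b t" using eq by simp
  then have "frac_eq c w b t" by (simp add: fraction_def frac_eq_sym)
  with cw show "frac_eq a s b t"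
    using assms by (intro frac_eq_trans[of a s c w b t]) (simp_all add: fraction_def)
next
  assume "frac_eq a s b t"
  with assms show "fraction a s = fraction b t"
    by (intro equalityI frac_subset) (simp_all add: frac_eq_sym)
qed

lemma frac_eqD:
  assumes "(b, t) \<in> fraction a s" "a \<in> carrier R" "s \<in> saturation"
  shows "fraction b t = fraction a s"
  using assms frac_eq_iff[of b a t s] by (simp add: fraction_def frac_eq_sym)

section \<open>The localization in terms of fractions\<close>

lemma loc_frac_eq_frac:
  assumes "a \<in> carrier R" "s \<in> S"
  shows "loc_frac R S a s = fraction a s"
proof -
  have "u \<otimes> (a \<otimes> t \<ominus> b \<otimes> s) = \<zero> \<longleftrightarrow> u \<otimes> (a \<otimes> t) = u \<otimes> (b \<otimes> s)"
    if "u \<in> S" "b \<in> carrier R" "t \<in> S" for u b t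
  proof -
    have "u \<otimes> (a \<otimes> t \<ominus> b \<otimes> s) = u \<otimes> (a \<otimes> t) \<ominus> u \<otimes> (b \<otimes> s)"
      using that assms by (simp add: minus_eq r_distr r_minus)
    then show ?thesis using that assms by (simp add: r_right_minus_eq)
  qed
  with assms show ?thesis
    by (auto simp: loc_frac_def loc_rel_def fraction_def frac_eq_def)
qed

text \<open>Denominators from the saturation add no new elements, since every such class has a
  representative over \<open>S\<close>. This permits working with the saturation, which is
  externally definable.\<close>

lemma carrier_localization:
  "carrier (localization R S) = {fraction a s | a s. a \<in> carrier R \<and> s \<in> saturation}"
proof -
  have "carrier (localization R S) = {fraction a s | a s. a \<in> carrier R \<and> s \<in> S}"
    by (force simp: localization_def quotient_def loc_frac_def[symmetric] loc_frac_eq_frac)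
  also have "\<dots> = {fraction a s | a s. a \<in> carrier R \<and> s \<in> saturation}"
  proof (intro equalityI subsetI)
    fix X assume "X \<in> {fraction a s | a s. a \<in> carrier R \<and> s \<in> saturation}"
    then obtain a s where as: "X = fraction a s" "a \<in> carrier R" "s \<in> saturation" by blast
    then obtain b t where bt: "(b, t) \<in> fraction a s" using frac_mem by blast
    with as frac_eqD have "X = fraction b t" by blast
    moreover have "b \<in> carrier R" "t \<in> S" using bt by (simp_all add: fraction_def)
    ultimately show "X \<in> {fraction a s | a s. a \<in> carrier R \<and> s \<in> S}" by blast
  qed (use S_saturation in blast)
  finally show ?thesis .
qed

text \<open>Both index sets are nonempty by \<open>frac_mem\<close>, so a union of equal sets
  collapses to their common value.\<close>

lemma UN_frac_const:
  assumes "a \<in> carrier R" "s \<in> saturation" "b \<in> carrier R" "t \<in> saturation"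
    and "\<And>a' s' b' t'. (a', s') \<in> fraction a s \<Longrightarrow> (b', t') \<in> fraction b t \<Longrightarrow> F a' s' b' t' = X"
  shows "(\<Union>(a', s')\<in>fraction a s. \<Union>(b', t')\<in>fraction b t. F a' s' b' t') = X"
proof -
  obtain a' s' b' t' where "(a', s') \<in> fraction a s" "(b', t') \<in> fraction b t"
    using frac_mem assms by meson
  with assms(5) show ?thesis by fast
qed

text \<open>The product is defined through representatives over \<open>S\<close>, but congruence
  carries the formula over to denominators in the saturation.\<close>

lemma localization_mult:
  assumes "a \<in> carrier R" "b \<in> carrier R" "s \<in> saturation" "t \<in> saturation"
  shows "fraction a s \<otimes>\<^bsub>localization R S\<^esub> fraction b t = fraction (a \<otimes> b) (s \<otimes> t)"
  unfolding localization_def monoid.simps ring.simps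
proof (rule UN_frac_const)
  fix a' s' b' t' assume *: "(a', s') \<in> fraction a s" "(b', t') \<in> fraction b t"
  then have "fraction (a \<otimes> b) (s \<otimes> t) = fraction (a' \<otimes> b') (s' \<otimes> t')"
    using assms by (subst frac_eq_iff) (auto simp: fraction_def intro!: frac_eq_mult)
  then show "loc_frac R S (a' \<otimes> b') (s' \<otimes> t') = fraction (a \<otimes> b) (s \<otimes> t)"
    using * by (subst loc_frac_eq_frac) (auto simp: fraction_def)
qed (use assms in auto)

lemma localization_add:
  assumes "a \<in> carrier R" "b \<in> carrier R" "s \<in> saturation" "t \<in> saturation"
  shows "fraction a s \<oplus>\<^bsub>localization R S\<^esub> fraction b t = fraction (a \<otimes> t \<oplus> b \<otimes> s) (s \<otimes> t)"
  unfolding localization_def ring.simps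
proof (rule UN_frac_const)
  fix a' s' b' t' assume *: "(a', s') \<in> fraction a s" "(b', t') \<in> fraction b t"
  then have "fraction (a \<otimes> t \<oplus> b \<otimes> s) (s \<otimes> t) = fraction (a' \<otimes> t' \<oplus> b' \<otimes> s') (s' \<otimes> t')"
    using assms by (subst frac_eq_iff) (auto simp: fraction_def intro!: frac_eq_add)
  then show "loc_frac R S (a' \<otimes> t' \<oplus> b' \<otimes> s') (s' \<otimes> t') = fraction (a \<otimes> t \<oplus> b \<otimes> s) (s \<otimes> t)"
    using * by (subst loc_frac_eq_frac) (auto simp: fraction_def)
qed (use assms in auto)

lemma localization_zero: "\<zero>\<^bsub>localization R S\<^esub> = fraction \<zero> \<one>"
  by (simp add: localization_def loc_frac_eq_frac)

lemma localization_one: "\<one>\<^bsub>localization R S\<^esub> = fraction \<one> \<one>"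
  by (simp add: localization_def loc_frac_eq_frac)

lemma frac_in_localization:
  "a \<in> carrier R \<Longrightarrow> s \<in> saturation \<Longrightarrow> fraction a s \<in> carrier (localization R S)"
  unfolding carrier_localization by blast

lemma localization_add_minus:
  assumes "a \<in> carrier R" "s \<in> saturation"
  shows "fraction (\<ominus> a) s \<oplus>\<^bsub>localization R S\<^esub> fraction a s = \<zero>\<^bsub>localization R S\<^esub>"
proof -
  have "\<ominus> a \<otimes> s \<oplus> a \<otimes> s = \<zero>"
    using assms by (simp add: l_minus l_neg)
  with assms show ?thesis
    unfolding localization_zero by (simp add: localization_add frac_eq_iff frac_eqI)
qed

text \<open>Established for the sake of \<open>localization_minus\<close>: additive inverses are
  given by a definite description, so computing one requires uniqueness.\<close>

lemma abelian_group_localization: "abelian_group (localization R S)"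
proof (rule abelian_groupI)
  fix x y z
  assume "x \<in> carrier (localization R S)" "y \<in> carrier (localization R S)"
    "z \<in> carrier (localization R S)"
  then obtain a s b t c w where
    x: "x = fraction a s" "a \<in> carrier R" "s \<in> saturation" and
    y: "y = fraction b t" "b \<in> carrier R" "t \<in> saturation" and
    z: "z = fraction c w" "c \<in> carrier R" "w \<in> saturation"
    by (auto simp: carrier_localization)
  have [simp]: "s \<in> carrier R" "t \<in> carrier R" "w \<in> carrier R"
    using x y z by auto
  show "x \<oplus>\<^bsub>localization R S\<^esub> y \<oplus>\<^bsub>localization R S\<^esub> z
      = x \<oplus>\<^bsub>localization R S\<^esub> (y \<oplus>\<^bsub>localization R S\<^esub> z)"
    using x y z by (simp add: localization_add frac_eq_iff frac_eqI l_distr r_distr a_ac m_ac)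
next
  fix x y
  assume "x \<in> carrier (localization R S)" "y \<in> carrier (localization R S)"
  then obtain a s b t where
    x: "x = fraction a s" "a \<in> carrier R" "s \<in> saturation" and
    y: "y = fraction b t" "b \<in> carrier R" "t \<in> saturation"
    by (auto simp: carrier_localization)
  then show "x \<oplus>\<^bsub>localization R S\<^esub> y \<in> carrier (localization R S)"
    by (simp add: localization_add frac_in_localization)
  show "x \<oplus>\<^bsub>localization R S\<^esub> y = y \<oplus>\<^bsub>localization R S\<^esub> x"
    using x y by (simp add: localization_add a_comm m_comm)
next
  show "\<zero>\<^bsub>localization R S\<^esub> \<in> carrier (localization R S)"
    by (simp add: localization_zero frac_in_localization)
next
  fix x assume "x \<in> carrier (localization R S)"
  then obtain a s where x: "x = fraction a s" "a \<in> carrier R" "s \<in> saturation"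
    by (auto simp: carrier_localization)
  then show "\<zero>\<^bsub>localization R S\<^esub> \<oplus>\<^bsub>localization R S\<^esub> x = x"
    by (simp add: localization_zero localization_add)
  show "\<exists>y\<in>carrier (localization R S). y \<oplus>\<^bsub>localization R S\<^esub> x = \<zero>\<^bsub>localization R S\<^esub>"
    using x localization_add_minus by (intro bexI[of _ "fraction (\<ominus> a) s"]) (auto simp: frac_in_localization)
qed

lemma localization_minus:
  assumes "a \<in> carrier R" "s \<in> saturation"
  shows "\<ominus>\<^bsub>localization R S\<^esub> fraction a s = fraction (\<ominus> a) s"
  by (rule abelian_group.minus_equality[OF abelian_group_localization localization_add_minus])
    (simp_all add: assms frac_in_localization)

section \<open>Externally definable relations between fractions\<close>

abbreviation RS :: "('a, ring_sym, unit) fo_struct" where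
  "RS \<equiv> ring_structure R"

lemma is_structure_ring: "is_structure ring_language RS"
  unfolding is_structure_def
proof (intro conjI ballI)
  show "univ RS \<noteq> {}" by (auto simp: ring_structure_def)
  fix f as assume "as \<in> tuples (univ RS) (fun_arity ring_language f)"
  moreover from this have "as ! i \<in> carrier R" if "i < fun_arity ring_language f" for i
    using that nth_mem[of i as] by (auto simp: tuples_def ring_structure_def)
  ultimately show "fun_interp RS f as \<in> univ RS"
    by (cases f) (simp_all add: ring_structure_def ring_language_def)
qed

text \<open>As \<open>S\<close> is directed under divisibility, there is an ultrafilter on \<open>S\<close> for which almost every
  \<open>x\<close> is a multiple of any given \<open>s \<in> S\<close>. The class of the identity is then a common multiple of
  \<open>S\<close> in the ultrapower.\<close>

lemma divisibility_ultrafilter: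
  obtains U where "U \<noteq> bot" "\<And>P. \<not> eventually P U \<Longrightarrow> eventually (\<lambda>x. \<not> P x) U"
    "\<And>s. s \<in> S \<Longrightarrow> \<forall>\<^sub>F x in U. x \<in> S \<and> (\<exists>r\<in>carrier R. r \<otimes> s = x)"
proof -
  define B where "B s = {x \<in> S. \<exists>r\<in>carrier R. r \<otimes> s = x}" for s
  define F where "F = (INF s\<in>S. principal (B s))"
  \<comment> \<open>Products witness directedness, so the sets \<open>B s\<close> form a filter
    base.\<close>
  have B_mult: "B (s \<otimes> t) \<subseteq> B s \<inter> B t" if "s \<in> S" "t \<in> S" for s t
  proof -
    have "r \<otimes> (s \<otimes> t) = (r \<otimes> t) \<otimes> s" "r \<otimes> (s \<otimes> t) = (r \<otimes> s) \<otimes> t" if "r \<in> carrier R" for r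
      using that \<open>s \<in> S\<close> \<open>t \<in> S\<close> by (simp_all add: m_ac)
    then show ?thesis using that by (force simp: B_def)
  qed
  have F: "eventually P F \<longleftrightarrow> (\<exists>s\<in>S. eventually P (principal (B s)))" for P
    unfolding F_def
  proof (rule eventually_INF_base)
    fix s t assume "s \<in> S" "t \<in> S"
    then show "\<exists>x\<in>S. principal (B x) \<le> inf (principal (B s)) (principal (B t))"
      using B_mult by (intro bexI[of _ "s \<otimes> t"]) auto
  qed (use S_one in blast)
  \<comment> \<open>The base sets are nonempty, which makes \<open>F\<close> proper.\<close>
  have "s \<in> B s" if "s \<in> S" for s
    using that by (auto simp: B_def intro!: bexI[of _ \<one>])
  then have "F \<noteq> bot"
    by (auto simp: trivial_limit_def F eventually_principal)
  then obtain U where U: "U \<le> F" "U \<noteq> bot"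
    "\<And>P. \<not> eventually P U \<Longrightarrow> eventually (\<lambda>x. \<not> P x) U"
    by (rule finer_ultrafilter) blast
  have "\<forall>\<^sub>F x in U. x \<in> S \<and> (\<exists>r\<in>carrier R. r \<otimes> s = x)" if "s \<in> S" for s
  proof -
    have "eventually (\<lambda>x. x \<in> B s) F"
      using that by (auto simp: F eventually_principal)
    with U(1) have "eventually (\<lambda>x. x \<in> B s) U" by (rule filter_leD)
    then show ?thesis by (simp add: B_def)
  qed
  with U that show thesis by blast
qed

lemma eval_trm_carrier:
  assumes "wf_trm ring_language p" "\<And>i. i \<in> vars_trm p \<Longrightarrow> e i \<in> carrier R"
  shows "eval_trm RS e p \<in> carrier R"
  using assms
proof (induction p)
  case (App f ts)
  then have "map (eval_trm RS e) ts \<in> tuples (univ RS) (fun_arity ring_language f)"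
    by (auto simp: tuples_def ring_structure_def)
  with is_structure_ring App.prems show ?case
    by (auto simp: is_structure_def ring_structure_def)
qed simp

text \<open>With \<open>x\<close> the common multiple of \<open>S\<close> from above, \<open>s\<close> is in the saturation iff \<open>s\<close> divides \<open>x\<close>,
  and two elements are equalized by an element of \<open>S\<close> iff they are equalized by \<open>x\<close>.\<close>

lemma definable_frac_eq:
  fixes J :: "nat list"
  assumes J: "set J \<subseteq> {..<n}"
    and pq: "\<And>r. r \<in> {p, s, q, t} \<Longrightarrow> wf_trm ring_language r \<and> vars_trm r \<subseteq> {..<n}"
  shows "definable (shelah_language ring_language RS) (shelah_expansion RS) n
    {as \<in> tuples (carrier R) n. (\<forall>i\<in>set J. as ! i \<in> saturation) \<and>
       frac_eq (eval_trm RS ((!) as) p) (eval_trm RS ((!) as) s)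
         (eval_trm RS ((!) as) q) (eval_trm RS ((!) as) t)}"
proof (rule definable_shelah_expansion)
  let ?mul = "\<lambda>p q. App Mult_sym [p, q]"
  \<comment> \<open>Variables \<open>0\<close> to \<open>n - 1\<close> hold the tuple, variable
    \<open>n\<close> holds the parameter \<open>x\<close>, and \<open>Suc n\<close> is bound to the
    cofactor showing that entry \<open>i\<close> divides \<open>x\<close>.\<close>
  define dv :: "nat \<Rightarrow> (ring_sym, unit) fm"
    where "dv i = Exists (Suc n) (Eq (?mul (Var (Suc n)) (Var i)) (Var n))" for i
  define E :: "(ring_sym, unit) fm"
    where "E = Eq (?mul (Var n) (?mul p t)) (?mul (Var n) (?mul q s))"
  define \<phi> where "\<phi> = foldr (\<lambda>i. Conj (dv i)) J E"
  obtain U where U: "U \<noteq> bot" "\<And>P. \<not> eventually P U \<Longrightarrow> eventually (\<lambda>x. \<not> P x) U"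
    and US: "\<And>s. s \<in> S \<Longrightarrow> \<forall>\<^sub>F x in U. x \<in> S \<and> (\<exists>r\<in>carrier R. r \<otimes> s = x)"
    using divisibility_ultrafilter by blast
  have carrier: "\<forall>\<^sub>F x in U. x \<in> univ RS"
    using US[OF S_one] by (auto simp: ring_structure_def elim: eventually_mono)
  have "formula ring_language (n + 1) (dv i)" if "i < n" for i
    using that by (auto simp: formula_def dv_def ring_language_def)
  moreover have "formula ring_language (n + 1) E"
    using pq[of p] pq[of q] pq[of s] pq[of t]
    by (auto simp: formula_def E_def ring_language_def)
  ultimately have \<phi>: "formula ring_language (n + 1) \<phi>"
    unfolding \<phi>_def using J by (induction J) (auto simp: formula_def)
  have foldr: "sat RS e (foldr (\<lambda>i. Conj (dv i)) J E)
      \<longleftrightarrow> (\<forall>i\<in>set J. sat RS e (dv i)) \<and> sat RS e E" for e J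
    by (induction J) auto
  have "(\<forall>\<^sub>F x in U. holds RS \<phi> (as @ [x])) \<longleftrightarrow>
      (\<forall>i\<in>set J. as ! i \<in> saturation) \<and>
       frac_eq (eval_trm RS ((!) as) p) (eval_trm RS ((!) as) s)
         (eval_trm RS ((!) as) q) (eval_trm RS ((!) as) t)"
    if as: "as \<in> tuples (carrier R) n" for as
  proof -
    let ?ev = "eval_trm RS ((!) as)"
    have len: "length as = n" and as_carrier: "\<And>i. i < n \<Longrightarrow> as ! i \<in> carrier R"
      using as by (auto simp: tuples_def)
    have ev: "eval_trm RS ((!) (as @ [x])) r = ?ev r" "?ev r \<in> carrier R"
      if "r \<in> {p, s, q, t}" for r x
      using pq[OF that] as_carrier by (auto simp: len nth_append intro!: eval_trm_cong eval_trm_carrier)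
    have "sat RS ((!) (as @ [x])) (dv i) \<longleftrightarrow> (\<exists>r\<in>carrier R. r \<otimes> as ! i = x)"
      if "i \<in> set J" for x i
      using that J by (auto simp: dv_def ring_structure_def nth_append len)
    moreover have "sat RS ((!) (as @ [x])) E
        \<longleftrightarrow> x \<otimes> (?ev p \<otimes> ?ev t) = x \<otimes> (?ev q \<otimes> ?ev s)" for x
    proof -
      have mul: "fun_interp RS Mult_sym [a, b] = a \<otimes> b" for a b
        by (simp add: ring_structure_def)
      show ?thesis by (simp add: E_def mul ev len nth_append)
    qed
    ultimately have holds: "holds RS \<phi> (as @ [x]) \<longleftrightarrow>
        (\<forall>i\<in>set J. \<exists>r\<in>carrier R. r \<otimes> as ! i = x) \<and>
        x \<otimes> (?ev p \<otimes> ?ev t) = x \<otimes> (?ev q \<otimes> ?ev s)" for x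
      by (simp add: holds_def \<phi>_def foldr)
    show ?thesis
    proof
      assume "\<forall>\<^sub>F x in U. holds RS \<phi> (as @ [x])"
      with US[OF S_one] have "\<forall>\<^sub>F x in U. x \<in> S \<and> holds RS \<phi> (as @ [x])"
        by eventually_elim simp
      \<comment> \<open>As \<open>U\<close> is proper, some actual \<open>x\<close> in
        \<open>S\<close> satisfies the formula. Entries dividing it lie in the saturation, and it
        serves itself as the multiplier in \<open>frac_eq\<close>.\<close>
      then obtain x where x: "x \<in> S" "holds RS \<phi> (as @ [x])"
        using eventually_happens' U(1) by blast
      show "(\<forall>i\<in>set J. as ! i \<in> saturation) \<and> frac_eq (?ev p) (?ev s) (?ev q) (?ev t)"
      proof (intro conjI ballI)
        fix i assume i: "i \<in> set J"
        with x obtain r where "r \<in> carrier R" "r \<otimes> as ! i = x"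
          unfolding holds by blast
        with x(1) i J as_carrier show "as ! i \<in> saturation"
          unfolding saturation_def by blast
      next
        show "frac_eq (?ev p) (?ev s) (?ev q) (?ev t)"
          using x unfolding holds frac_eq_def by blast
      qed
    next
      assume *: "(\<forall>i\<in>set J. as ! i \<in> saturation) \<and> frac_eq (?ev p) (?ev s) (?ev q) (?ev t)"
      \<comment> \<open>Some multiple of the entry lies in \<open>S\<close>, and almost every
        \<open>x\<close> is a multiple of that one.\<close>
      have "\<forall>\<^sub>F x in U. \<exists>r\<in>carrier R. r \<otimes> as ! i = x" if "i \<in> set J" for i
      proof -
        have "as ! i \<in> saturation" using * that by blast
        then obtain r where r: "r \<in> carrier R" "r \<otimes> as ! i \<in> S"
          unfolding saturation_def by blast
        have "as ! i \<in> carrier R" using that J as_carrier by auto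
        with r have "r' \<otimes> (r \<otimes> as ! i) = (r' \<otimes> r) \<otimes> as ! i" if "r' \<in> carrier R" for r'
          using that by (simp add: m_assoc)
        with r(1) show ?thesis
          by (intro eventually_mono[OF US[OF r(2)]]) (metis m_closed)
      qed
      then have 1: "\<forall>\<^sub>F x in U. \<forall>i\<in>set J. \<exists>r\<in>carrier R. r \<otimes> as ! i = x"
        by (intro eventually_ball_finite) auto
      \<comment> \<open>Almost every \<open>x\<close> is a multiple of \<open>u\<close>, so it
        equalizes the two products as well.\<close>
      obtain u where u: "u \<in> S" "u \<otimes> (?ev p \<otimes> ?ev t) = u \<otimes> (?ev q \<otimes> ?ev s)"
        using * by (auto simp: frac_eq_def)
      have 2: "\<forall>\<^sub>F x in U. x \<otimes> (?ev p \<otimes> ?ev t) = x \<otimes> (?ev q \<otimes> ?ev s)"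
      proof (rule eventually_mono[OF US[OF u(1)]], elim conjE bexE)
        fix x r assume "r \<in> carrier R" "r \<otimes> u = x"
        moreover have "?ev p \<otimes> ?ev t \<in> carrier R" "?ev q \<otimes> ?ev s \<in> carrier R"
          by (simp_all add: ev(2))
        ultimately show "x \<otimes> (?ev p \<otimes> ?ev t) = x \<otimes> (?ev q \<otimes> ?ev s)"
          using u by (metis S_carrier m_assoc)
      qed
      from 1 2 show "\<forall>\<^sub>F x in U. holds RS \<phi> (as @ [x])"
        unfolding holds by eventually_elim simp
    qed
  qed
  then have "{as \<in> tuples (carrier R) n. (\<forall>i\<in>set J. as ! i \<in> saturation) \<and>
       frac_eq (eval_trm RS ((!) as) p) (eval_trm RS ((!) as) s)
         (eval_trm RS ((!) as) q) (eval_trm RS ((!) as) t)}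
      = {as \<in> tuples (carrier R) n. \<forall>\<^sub>F x in U. holds RS \<phi> (as @ [x])}"
    by blast
  moreover have "univ RS = carrier R" by (simp add: ring_structure_def)
  ultimately show "externally_definable ring_language RS n
    {as \<in> tuples (carrier R) n. (\<forall>i\<in>set J. as ! i \<in> saturation) \<and>
       frac_eq (eval_trm RS ((!) as) p) (eval_trm RS ((!) as) s)
         (eval_trm RS ((!) as) q) (eval_trm RS ((!) as) t)}"
    using externally_definable_eventually[OF is_structure_ring U carrier \<phi>] by simp
qed

section \<open>The interpretation on pairs of numerator and denominator\<close>

definition fractions :: "'a list set" where
  "fractions = (\<lambda>(a, s). [a, s]) ` (carrier R \<times> saturation)"

definition fraction_of :: "'a list \<Rightarrow> ('a \<times> 'a) set" where
  "fraction_of d = fraction (d ! 0) (d ! 1)"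

text \<open>Both coordinates range over the carrier and the saturation becomes a side condition,
  which is the shape that \<open>UN_tuples\<close> gives to sets of tuples over
  \<open>carrier R\<close>.\<close>

lemma UN_fractions:
  "(\<Union>d\<in>fractions. F d)
   = (\<Union>a\<in>carrier R. \<Union>s\<in>carrier R. if s \<in> saturation then F [a, s] else {})"
proof -
  have "(\<Union>d\<in>fractions. F d) = (\<Union>a\<in>carrier R. \<Union>s\<in>saturation. F [a, s])"
    by (auto simp: fractions_def)
  also have "\<dots> = (\<Union>a\<in>carrier R. \<Union>s\<in>carrier R. if s \<in> saturation then F [a, s] else {})"
    by (force split: if_splits)
  finally show ?thesis .
qed

lemma UN_tuples:
  "(\<Union>as\<in>tuples A 0. F as) = F []"
  "(\<Union>as\<in>tuples A (Suc n). F as) = (\<Union>a\<in>A. \<Union>as\<in>tuples A n. F (a # as))"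
proof -
  have "tuples A 0 = {[]}" "tuples A (Suc n) = (\<Union>a\<in>A. (#) a ` tuples A n)"
    by (auto simp: tuples_def length_Suc_conv)
  then show "(\<Union>as\<in>tuples A 0. F as) = F []"
    "(\<Union>as\<in>tuples A (Suc n). F as) = (\<Union>a\<in>A. \<Union>as\<in>tuples A n. F (a # as))"
    by simp_all
qed

text \<open>A form of \<open>definable_frac_eq\<close> in which the set is a union of singletons, so
  that its use leaves an equality of two nested unions.\<close>

lemma definable_UN:
  fixes J :: "nat list"
  assumes "set J \<subseteq> {..<n}"
    and "\<And>r. r \<in> {p, s, q, t} \<Longrightarrow> wf_trm ring_language r \<and> vars_trm r \<subseteq> {..<n}"
    and "X = (\<Union>as\<in>tuples (carrier R) n. {x. x = as \<and> (\<forall>i\<in>set J. as ! i \<in> saturation) \<and>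
      frac_eq (eval_trm RS ((!) as) p) (eval_trm RS ((!) as) s)
         (eval_trm RS ((!) as) q) (eval_trm RS ((!) as) t)})"
  shows "definable (shelah_language ring_language RS) (shelah_expansion RS) n X"
proof -
  have "X = {as \<in> tuples (carrier R) n. (\<forall>i\<in>set J. as ! i \<in> saturation) \<and>
      frac_eq (eval_trm RS ((!) as) p) (eval_trm RS ((!) as) s)
         (eval_trm RS ((!) as) q) (eval_trm RS ((!) as) t)}"
    unfolding assms(3) by blast
  with definable_frac_eq[OF assms(1,2)] show ?thesis by simp
qed

text \<open>These rules move the conditions in nested unions of singletons to the place where their
  variables are bound, so that two such unions can be compared by simplification.\<close>

lemma UN_conditions:
  "{x. x = a \<and> P} = (if P then {a} else {})"
  "(if P \<and> Q then A else {}) = (if P then if Q then A else {} else {})"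
  "(\<Union>x\<in>B. if P then F x else {}) = (if P then \<Union>x\<in>B. F x else {})"
  by auto

lemmas UN_simps = UN_conditions UN_fractions UN_tuples numeral_eq_Suc ring_language_def
  ring_structure_def fraction_of_def frac_eq_iff localization_zero localization_one
  localization_add localization_mult localization_minus

text \<open>A fraction occupies two consecutive entries, numerator at an even and denominator at an
  odd position. Thus \<open>J\<close> lists the odd positions, and the four terms are numerator and
  denominator of the value of \<open>f\<close> and of the last fraction.\<close>

lemma definable_fun_graph:
  "definable (shelah_language ring_language RS) (shelah_expansion RS)
     (fun_arity ring_language f * 2 + 2)
     {concat ds @ d | ds d. ds \<in> tuples fractions (fun_arity ring_language f) \<and> d \<in> fractions \<and>
        fun_interp (ring_structure (localization R S)) f (map fraction_of ds) = fraction_of d}"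
    (is "definable ?L ?M _ ?X")
proof -
  have X: "?X = (\<Union>ds\<in>tuples fractions (fun_arity ring_language f). \<Union>d\<in>fractions.
      {x. x = concat ds @ d \<and>
        fun_interp (ring_structure (localization R S)) f (map fraction_of ds) = fraction_of d})"
    by blast
  let ?mul = "\<lambda>p q. App Mult_sym [p, q]"
  show ?thesis
  proof (cases f)
    case Zero_sym
    show ?thesis unfolding X unfolding Zero_sym
      by (rule definable_UN[of "[1]" _ "App Zero_sym []" "App One_sym []" "Var 0" "Var 1"],
          simp add: ring_language_def, force simp: ring_language_def)
        (simp add: UN_simps cong: SUP_cong if_cong)
  next
    case One_sym
    show ?thesis unfolding X unfolding One_sym
      by (rule definable_UN[of "[1]" _ "App One_sym []" "App One_sym []" "Var 0" "Var 1"],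
          simp add: ring_language_def, force simp: ring_language_def)
        (simp add: UN_simps cong: SUP_cong if_cong)
  next
    case Add_sym
    show ?thesis unfolding X unfolding Add_sym
      by (rule definable_UN[of "[1, 3, 5]" _
            "App Add_sym [?mul (Var 0) (Var 3), ?mul (Var 2) (Var 1)]" "?mul (Var 1) (Var 3)"
            "Var 4" "Var 5"],
          simp add: ring_language_def, force simp: ring_language_def)
        (simp add: UN_simps cong: SUP_cong if_cong)
  next
    case Minus_sym
    show ?thesis unfolding X unfolding Minus_sym
      by (rule definable_UN[of "[1, 3]" _ "App Minus_sym [Var 0]" "Var 1" "Var 2" "Var 3"],
          simp add: ring_language_def, force simp: ring_language_def)
        (simp add: UN_simps cong: SUP_cong if_cong)
  next
    case Mult_sym
    show ?thesis unfolding X unfolding Mult_sym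
      by (rule definable_UN[of "[1, 3, 5]" _ "?mul (Var 0) (Var 2)" "?mul (Var 1) (Var 3)"
            "Var 4" "Var 5"],
          simp add: ring_language_def, force simp: ring_language_def)
        (simp add: UN_simps cong: SUP_cong if_cong)
  qed
qed

lemma is_interpretation_localization:
  "is_interpretation (shelah_language ring_language RS) (shelah_expansion RS)
     ring_language (ring_structure (localization R S)) 2 fractions fraction_of"
  unfolding is_interpretation_def
proof (intro conjI ballI)
  let ?L = "shelah_language ring_language RS" and ?M = "shelah_expansion RS"
  show "definable ?L ?M 2 fractions"
    \<comment> \<open>With four equal terms \<open>frac_eq\<close> holds trivially, which leaves
      only the condition on the denominator.\<close>
    by (rule definable_UN[of "[1]" _ "Var 0" "Var 0" "Var 0" "Var 0"])
      (auto simp: fractions_def UN_tuples numeral_eq_Suc frac_eqI)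
  show "fraction_of ` fractions = univ (ring_structure (localization R S))"
    by (force simp: fractions_def fraction_of_def ring_structure_def carrier_localization)
  have "{d @ d' | d d'. d \<in> fractions \<and> d' \<in> fractions \<and> fraction_of d = fraction_of d'}
      = (\<Union>d\<in>fractions. \<Union>d'\<in>fractions. {x. x = d @ d' \<and> fraction_of d = fraction_of d'})"
    by blast
  then show "definable ?L ?M (2 + 2)
      {d @ d' | d d'. d \<in> fractions \<and> d' \<in> fractions \<and> fraction_of d = fraction_of d'}"
    by (intro definable_UN[of "[1, 3]" _ "Var 0" "Var 1" "Var 2" "Var 3"], simp, force)
      (simp add: UN_simps cong: SUP_cong if_cong)
  show "definable ?L ?M (fun_arity ring_language f * 2 + 2)
     {concat ds @ d | ds d. ds \<in> tuples fractions (fun_arity ring_language f) \<and> d \<in> fractions \<and>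
        fun_interp (ring_structure (localization R S)) f (map fraction_of ds) = fraction_of d}"
    for f by (rule definable_fun_graph)
qed (simp add: ring_language_def)

text \<open>The canonical map sends \<open>a\<close> to \<open>a/1\<close>. Entry 0 is now the ring
  element, so the denominator of the fraction moves to position 2.\<close>

lemma definable_map_graph:
  "definable (shelah_language ring_language RS) (shelah_expansion RS) (1 + 2)
     {[a] @ d | a d. a \<in> univ (shelah_expansion RS) \<and> d \<in> fractions \<and>
        localization_map R S a = fraction_of d}"
proof -
  have "{[a] @ d | a d. a \<in> univ (shelah_expansion RS) \<and> d \<in> fractions \<and>
        localization_map R S a = fraction_of d}
      = (\<Union>a\<in>carrier R. \<Union>d\<in>fractions. {x. x = a # d \<and> fraction a \<one> = fraction_of d})"
    by (auto simp: shelah_expansion_def ring_structure_def localization_map_def loc_frac_eq_frac)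
  then show ?thesis
    by (intro definable_UN[of "[2]" _ "Var 0" "App One_sym []" "Var 1" "Var 2"], simp,
          force simp: ring_language_def)
      (simp add: UN_simps cong: SUP_cong if_cong)
qed

end

theorem theorem2p10:
  fixes R :: "('a, 'm) ring_scheme" and S :: "'a set"
  assumes "cring R" and "NIP_ring R" and "submonoid S R"
  shows "interpretable_with_map
    (shelah_language ring_language (ring_structure R)) (shelah_expansion (ring_structure R))
    ring_language (ring_structure (localization R S)) (localization_map R S)"
proof -
  interpret localized_ring R S
    using assms by (simp add: localized_ring_def localized_ring_axioms_def)
  show ?thesis
    unfolding interpretable_with_map_def
    using is_interpretation_localization definable_map_graph by blast
qed

end
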